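(* Let $m\ge 3$ be an integer, $n=2^m-3$, and let $C_1\subset V(H^n)$ be an $(n,2^{2^m-m-3},3)$ code. Let $$C_2=\{\bar x\mid \bar x+\bar 1\in C_1\},\qquad C_3=\{\bar x\mid d(\bar x,C_1)=1\}\setminus C_2,\qquad C_4=V(H^n)\setminus(C_1\cup C_2\cup C_3).$$ Let $B$ be the unique twofold $1$-perfect code in $V(H^{n+2})$ such that $C_100\subset B$, every word of $C_100$ has multiplicity $2$ in $B$, and every codeword $\bar x$ of $B$ with last two symbols $01$ or $10$ satisfies $\bar x+0\ldots011\in B$. Let $D$ be the unique twofold $1$-perfect code in $V(H^{n+2})$ such that $C_100\subset D$ and every codeword $\bar x$ of $D$ satisfies $\bar x+0\ldots011\in D$. (Both $B$ and $D$ exist and are unique.) Then the following four statements are mutually equivalent: (a) the set $C_100$ is a subset of a $1$-perfect code $C\subset V(H^{n+2})$; (b) the set $C_4$ is splittable; (c) the twofold $1$-perfect code $B$ is splittable; (d) the twofold $1$-perfect code $D$ is splittable.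
   Context: $H^n$ is the graph (hypercube) whose vertex set $V(H^n)$ is the set of all binary words of length $n$, two words being adjacent iff they differ in exactly one position. $d(\cdot,\cdot)$ is the Hamming distance, and $d(\bar x,C)=\min_{\bar y\in C}d(\bar x,\bar y)$. $\bar 1$ is the all-one word, $0\ldots011$ is the word with ones exactly in the last two positions, and addition of words is coordinatewise modulo $2$. For $\bar x=x_1\ldots x_n$, $\bar x00$ denotes the word $x_1\ldots x_n00$, and $C_100=\{\bar x00\mid\bar x\in C_1\}\subset V(H^{n+2})$. An $(n,|C|,d)$ code is a subset $C\subset V(H^n)$ such that $d(\bar x,\bar y)\ge d$ for any two different $\bar x,\bar y\in C$; a distance-$3$ code is a set of words such that any two different words are at distance at least $3$. A code $C\subset V(H^N)$ is $1$-perfect if every vertex of $H^N$ is at distance $0$ or $1$ from exactly one codeword of $C$. A twofold $1$-perfect code in $V(H^N)$ is a multiset of words of $V(H^N)$ such that every vertex of $H^N$ is at distance $0$ or $1$ from exactly two codewords (counted with multiplicity). A multiset (in particular, a set) of words is splittable if it is the multiset union (multiplicities add) of two distance-$3$ codes; otherwise it is unsplittable. *)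

theory Defs
  imports Main "HOL-Library.Multiset"
begin

type_synonym word = "bool list"

definition words :: "nat \<Rightarrow> word set" where
  "words n = {x. length x = n}"

text \<open>The distance and the sum are only meaningful for words of equal length.\<close>

definition hdist :: "word \<Rightarrow> word \<Rightarrow> nat" where
  "hdist x y = card {i. i < length x \<and> x ! i \<noteq> y ! i}"

definition wadd :: "word \<Rightarrow> word \<Rightarrow> word" where
  "wadd x y = map2 (\<noteq>) x y"

text \<open>Only used for finite nonempty \<open>C\<close>, where \<^const>\<open>Min\<close> is the minimum.\<close>

definition hdist_set :: "word \<Rightarrow> word set \<Rightarrow> nat" where
  "hdist_set x C = Min (hdist x ` C)"

definition ones :: "nat \<Rightarrow> word" where
  "ones n = replicate n True"

definition zeros_11 :: "nat \<Rightarrow> word" where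
  "zeros_11 n = replicate n False @ [True, True]"

definition append_00 :: "word set \<Rightarrow> word set" where
  "append_00 C = {x @ [False, False] | x. x \<in> C}"

definition distance_code :: "nat \<Rightarrow> nat \<Rightarrow> word set \<Rightarrow> bool" where
  "distance_code n d C \<longleftrightarrow> C \<subseteq> words n \<and> (\<forall>x\<in>C. \<forall>y\<in>C. x \<noteq> y \<longrightarrow> d \<le> hdist x y)"

definition code_params :: "nat \<Rightarrow> nat \<Rightarrow> nat \<Rightarrow> word set \<Rightarrow> bool" where
  "code_params n M d C \<longleftrightarrow> distance_code n d C \<and> card C = M"

definition one_perfect :: "nat \<Rightarrow> word set \<Rightarrow> bool" where
  "one_perfect N C \<longleftrightarrow> C \<subseteq> words N \<and> (\<forall>x\<in>words N. \<exists>!c. c \<in> C \<and> hdist x c \<le> 1)"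

definition twofold_one_perfect :: "nat \<Rightarrow> word multiset \<Rightarrow> bool" where
  "twofold_one_perfect N M \<longleftrightarrow>
     set_mset M \<subseteq> words N \<and> (\<forall>x\<in>words N. size {#c \<in># M. hdist x c \<le> 1#} = 2)"

text \<open>A set \<open>C\<close> of words counts as the multiset \<open>mset_set C\<close>. Subsets of \<^term>\<open>words N\<close>
  are finite, so \<^const>\<open>mset_set\<close> has its intended meaning here.\<close>

definition splittable :: "nat \<Rightarrow> word multiset \<Rightarrow> bool" where
  "splittable N M \<longleftrightarrow>
     (\<exists>X Y. distance_code N 3 X \<and> distance_code N 3 Y \<and> M = mset_set X + mset_set Y)"

text \<open>In the next two definitions the words have length \<open>n + 2\<close>, so \<^term>\<open>drop n x\<close> consists of the
  last two symbols of \<open>x\<close>. Membership in a multiset means positive multiplicity.\<close>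

definition doubled_extension :: "nat \<Rightarrow> word set \<Rightarrow> word multiset \<Rightarrow> bool" where
  "doubled_extension n C1 B \<longleftrightarrow>
     twofold_one_perfect (n + 2) B \<and>
     append_00 C1 \<subseteq> set_mset B \<and>
     (\<forall>x\<in>append_00 C1. count B x = 2) \<and>
     (\<forall>x. x \<in># B \<and> drop n x \<in> {[False, True], [True, False]} \<longrightarrow> wadd x (zeros_11 n) \<in># B)"

definition symmetric_extension :: "nat \<Rightarrow> word set \<Rightarrow> word multiset \<Rightarrow> bool" where
  "symmetric_extension n C1 D \<longleftrightarrow>
     twofold_one_perfect (n + 2) D \<and>
     append_00 C1 \<subseteq> set_mset D \<and>
     (\<forall>x. x \<in># D \<longrightarrow> wadd x (zeros_11 n) \<in># D)"

end

theory Submission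
  imports Defs
begin

text \<open>
Write \<open>T\<close> for the operator that sums a function over the balls of radius 1, and identify sets with
their indicator functions. The proof rests on three identities between functions on the hypercube,
\<open>T C\<^sub>1 = T C\<^sub>2 = 1 - C\<^sub>4\<close> and \<open>T C\<^sub>4 = 2 - 2 C\<^sub>1 - 2 C\<^sub>2\<close>,
which say that the four sets form an equitable partition; in particular \<open>C\<^sub>1\<close> and \<open>C\<^sub>2\<close> are
disjoint.

The identities come from Fourier analysis (\<open>spectrum\<close>). The character of a set of \<open>k\<close> coordinates
is an eigenfunction of \<open>T\<close> for \<open>\<mu> = n + 1 - 2k\<close> and of the antipodal map for \<open>(-1)^k\<close>. The
number \<open>\<mu>\<^sup>2 - 2 - 2 (-1)^k\<close> is never negative: for even \<open>k\<close> this holds because \<open>n + 1\<close> is 2 modulo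
4. Parseval's identity turns the sum of the squared Fourier coefficients of \<open>C\<^sub>1\<close> with these weights
into counts of codeword pairs at distance at most 2 or at distance \<open>n\<close>. For the given cardinality the
resulting linear programming bound is tight. So the Fourier coefficients of \<open>C\<^sub>1\<close> vanish except at the
empty set, where \<open>\<mu> = 0\<close> (\<open>k\<close> odd), and where \<open>\<mu> = \<plusminus>2\<close> (\<open>k\<close> even). The odd part gives
\<open>T (C\<^sub>1 - C\<^sub>2) = 0\<close>; the even part gives that \<open>T (T F) - 4 F\<close> is constant for \<open>F = C\<^sub>1 + C\<^sub>2\<close>.

A multiset of words of length \<open>n + 2\<close> consists of four layers, one for each choice of the last two
symbols, and the condition to be twofold 1-perfect is a system of equations between the layers and
their images under \<open>T\<close>. By the identities above the layers 00, 01, 10, 11 with multiplicities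
\<open>2 C\<^sub>1, C\<^sub>4, C\<^sub>4, 2 C\<^sub>2\<close> give the multiset \<open>B\<close>, and \<open>C\<^sub>1 + C\<^sub>2, C\<^sub>4, C\<^sub>4, C\<^sub>1 + C\<^sub>2\<close> give \<open>D\<close>.
For uniqueness (\<open>doubled_extension_iff\<close>, \<open>symmetric_extension_iff\<close>), the excess of the layer 00 over
the stated one is nonnegative and has ball sum 0 at each word outside \<open>C\<^sub>4\<close>. Since every word lies in
the ball of such a word, there is no excess, and the equations determine the other layers.

If \<open>C\<^sub>4\<close> is split into distance-3 codes \<open>X\<close> and \<open>Y\<close>, then the layers \<open>C\<^sub>1, X, Y, C\<^sub>2\<close> form a
1-perfect code, so (a) holds. Together with \<open>C\<^sub>1, Y, X, C\<^sub>2\<close> they add up to \<open>B\<close>, and together with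
\<open>C\<^sub>2, Y, X, C\<^sub>1\<close> to \<open>D\<close>. Conversely, the layers 01 of the parts of a splitting of \<open>B\<close> or of \<open>D\<close> split
\<open>C\<^sub>4\<close>. Finally, a 1-perfect code that contains \<open>C\<^sub>1\<close> on the layer 00, added to its image under
exchanging the last two symbols, has the defining properties of \<open>B\<close>; so \<open>B\<close> is split in this case.
\<close>

section \<open>Ball sums\<close>

definition flip :: "word \<Rightarrow> nat \<Rightarrow> word" where
  "flip x i = x[i := \<not> x ! i]"

text \<open>On functions on \<^term>\<open>words n\<close> this is the operator \<open>A + I\<close>, where \<open>A\<close> is the adjacency
  operator of the hypercube; values are integers so that counts can be subtracted.\<close>

definition ball_sum :: "nat \<Rightarrow> (word \<Rightarrow> int) \<Rightarrow> word \<Rightarrow> int" where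
  "ball_sum n h x = h x + (\<Sum>i<n. h (flip x i))"

abbreviation ind :: "word set \<Rightarrow> word \<Rightarrow> int" where
  "ind C x \<equiv> of_bool (x \<in> C)"

lemma mem_words [simp]: "x \<in> words n \<longleftrightarrow> length x = n"
  by (simp add: words_def)

lemma finite_words [simp]: "finite (words n)"
  using finite_lists_length_eq[of "UNIV :: bool set" n] by (simp add: words_def)

lemma card_words: "card (words n) = 2 ^ n"
  using card_lists_length_eq[of "UNIV :: bool set" n] by (simp add: words_def)

lemma length_flip [simp]: "length (flip x i) = length x"
  by (simp add: flip_def)

lemma flip_nth: "j < length x \<Longrightarrow> flip x i ! j = (if i = j then \<not> x ! j else x ! j)"
  by (simp add: flip_def nth_list_update)

lemma flip_flip [simp]: "flip (flip x i) i = x"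
  by (cases "i < length x") (auto simp: flip_def list_update_beyond)

lemma flip_neq: "i < length x \<Longrightarrow> flip x i \<noteq> x"
  by (metis flip_nth)

lemma inj_on_flip: "inj_on (flip x) {..<length x}"
  by (rule inj_onI) (metis flip_nth lessThan_iff)

lemma hdist_eq_0_iff: "length x = length y \<Longrightarrow> hdist x y = 0 \<longleftrightarrow> x = y"
  by (auto simp: hdist_def intro: nth_equalityI)

lemma hdist_le_1_iff:
  assumes "length x = length y"
  shows "hdist x y \<le> 1 \<longleftrightarrow> y = x \<or> (\<exists>i<length x. y = flip x i)"
proof
  assume "hdist x y \<le> 1"
  then consider "hdist x y = 0" | "hdist x y = 1" by linarith
  then show "y = x \<or> (\<exists>i<length x. y = flip x i)"
  proof cases
    case 1
    then show ?thesis using hdist_eq_0_iff[OF assms] by simp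
  next
    case 2
    then obtain i where i: "{i. i < length x \<and> x ! i \<noteq> y ! i} = {i}"
      unfolding hdist_def by (rule card_1_singletonE)
    then have "i < length x" by auto
    moreover have "y = flip x i"
    proof (rule nth_equalityI)
      fix j assume "j < length y"
      then show "y ! j = flip x i ! j"
        using i assms by (cases "j = i") (auto simp: flip_nth)
    qed (use assms in simp)
    ultimately show ?thesis by blast
  qed
next
  assume "y = x \<or> (\<exists>i<length x. y = flip x i)"
  then have "\<exists>i. {j. j < length x \<and> x ! j \<noteq> y ! j} \<subseteq> {i}"
    by (auto simp: flip_nth split: if_splits)
  then obtain i where "{j. j < length x \<and> x ! j \<noteq> y ! j} \<subseteq> {i}" ..
  from card_mono[OF _ this] show "hdist x y \<le> 1"
    unfolding hdist_def by simp
qed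

lemma ball_sum_eq_sum_ball:
  assumes "length x = n"
  shows "ball_sum n h x = (\<Sum>y\<in>{y \<in> words n. hdist x y \<le> 1}. h y)"
proof -
  have "{y \<in> words n. hdist x y \<le> 1} = insert x (flip x ` {..<n})"
    using assms hdist_le_1_iff[of x] by auto
  moreover have "x \<notin> flip x ` {..<n}"
    using flip_neq assms by (metis imageE lessThan_iff)
  ultimately show ?thesis
    using inj_on_flip[of x] assms by (simp add: ball_sum_def sum.reindex)
qed

lemma ball_sum_ind:
  assumes "length x = n" "C \<subseteq> words n"
  shows "ball_sum n (ind C) x = int (card {c \<in> C. hdist x c \<le> 1})"
proof -
  have "{y \<in> words n. hdist x y \<le> 1} \<inter> C = {c \<in> C. hdist x c \<le> 1}"
    using assms(2) by auto
  then show ?thesis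
    using assms(1) by (simp add: ball_sum_eq_sum_ball of_bool_def sum.If_cases del: mem_words)
qed

lemma ball_sum_add: "ball_sum n (\<lambda>y. g y + h y) x = ball_sum n g x + ball_sum n h x"
  and ball_sum_diff: "ball_sum n (\<lambda>y. g y - h y) x = ball_sum n g x - ball_sum n h x"
  and ball_sum_cmult: "ball_sum n (\<lambda>y. c * h y) x = c * ball_sum n h x"
  and ball_sum_const: "ball_sum n (\<lambda>y. c) x = (int n + 1) * c"
  by (simp_all add: ball_sum_def sum.distrib sum_subtractf sum_distrib_left algebra_simps)

lemma ball_sum_mono:
  assumes "length x = n" "\<And>y. length y = n \<Longrightarrow> g y \<le> h y"
  shows "ball_sum n g x \<le> ball_sum n h x"
  unfolding ball_sum_def using assms by (intro add_mono sum_mono) auto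

lemma ball_sum_cong:
  assumes "length x = n" "\<And>y. length y = n \<Longrightarrow> g y = h y"
  shows "ball_sum n g x = ball_sum n h x"
  unfolding ball_sum_def using assms by (intro arg_cong2[where f = "(+)"] sum.cong) auto

lemma ball_sum_ge:
  assumes "length x = n" "\<And>y. length y = n \<Longrightarrow> h y \<ge> 0"
  shows "h x \<le> ball_sum n h x"
  unfolding ball_sum_def using assms by (simp add: sum_nonneg)

lemma ball_sum_ge_neighbour:
  assumes "length x = n" "\<And>y. length y = n \<Longrightarrow> h y \<ge> 0" "i < n"
  shows "h x \<le> ball_sum n h (flip x i)"
proof -
  have "h (flip (flip x i) i) \<le> (\<Sum>j<n. h (flip (flip x i) j))"
    by (rule member_le_sum) (use assms in auto)
  then show ?thesis
    using assms(2)[of "flip x i"] assms(1) by (simp add: ball_sum_def)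
qed

lemma ball_sum_ind_pos:
  assumes "ball_sum n (ind C) x > 0" "x \<notin> C"
  obtains i where "i < n" "flip x i \<in> C"
proof -
  have "(\<Sum>i<n. ind C (flip x i)) \<noteq> 0"
    using assms by (simp add: ball_sum_def del: sum_of_bool_eq)
  then obtain i where "i \<in> {..<n}" "ind C (flip x i) \<noteq> 0"
    by (rule sum.not_neutral_contains_not_neutral)
  then show ?thesis by (intro that) auto
qed

section \<open>Codes in terms of ball sums\<close>

lemma one_perfect_iff_ball_sum:
  "one_perfect n C \<longleftrightarrow> C \<subseteq> words n \<and> (\<forall>x\<in>words n. ball_sum n (ind C) x = 1)"
proof -
  have "(\<exists>!c. c \<in> C \<and> hdist x c \<le> 1) \<longleftrightarrow> card {c \<in> C. hdist x c \<le> 1} = 1" for x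
  proof -
    have "(\<exists>!c. c \<in> C \<and> hdist x c \<le> 1) \<longleftrightarrow> (\<exists>a. \<forall>c. c \<in> C \<and> hdist x c \<le> 1 \<longleftrightarrow> c = a)"
      by metis
    also have "\<dots> \<longleftrightarrow> card {c \<in> C. hdist x c \<le> 1} = 1"
      by (simp only: One_nat_def card_1_singleton_iff set_eq_iff mem_Collect_eq singleton_iff)
    finally show ?thesis .
  qed
  then show ?thesis
    unfolding one_perfect_def by (auto simp: ball_sum_ind)
qed

text \<open>Two words at distance at most 2 lie in a common ball of radius 1, and conversely.\<close>

lemma distance_code_3_iff_ball_sum:
  "distance_code n 3 C \<longleftrightarrow> C \<subseteq> words n \<and> (\<forall>x\<in>words n. ball_sum n (ind C) x \<le> 1)"
proof (cases "C \<subseteq> words n")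
  case True
  have fin: "finite {c \<in> C. hdist x c \<le> 1}" for x
    using finite_subset[OF True] by simp
  have "(\<forall>c\<in>C. \<forall>d\<in>C. c \<noteq> d \<longrightarrow> 3 \<le> hdist c d)
    \<longleftrightarrow> (\<forall>x\<in>words n. \<forall>c\<in>C. \<forall>d\<in>C. hdist x c \<le> 1 \<longrightarrow> hdist x d \<le> 1 \<longrightarrow> c = d)"
    (is "?far \<longleftrightarrow> ?disj")
  proof
    assume far: ?far
    show ?disj
    proof (intro ballI impI, rule ccontr)
      fix x c d assume *: "x \<in> words n" "c \<in> C" "d \<in> C" "hdist x c \<le> 1" "hdist x d \<le> 1" "c \<noteq> d"
      have "length c = n" using * True by auto
      then have "{i. i < length c \<and> c ! i \<noteq> d ! i}
          \<subseteq> {i. i < length x \<and> x ! i \<noteq> c ! i} \<union> {i. i < length x \<and> x ! i \<noteq> d ! i}"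
        using * by auto
      from card_mono[OF _ this] have "hdist c d \<le> hdist x c + hdist x d"
        unfolding hdist_def by (rule order_trans[OF _ card_Un_le]) simp
      moreover have "3 \<le> hdist c d" using far * by blast
      ultimately show False using * by linarith
    qed
  next
    assume disj: ?disj
    show ?far
    proof (intro ballI impI, rule ccontr)
      fix c d assume *: "c \<in> C" "d \<in> C" "c \<noteq> d" "\<not> 3 \<le> hdist c d"
      then have len: "length c = n" "length d = n" using True by auto
      let ?D = "{i. i < length c \<and> c ! i \<noteq> d ! i}"
      have "card ?D \<le> 2" using * by (simp add: hdist_def)
      obtain i where i: "i \<in> ?D"
        using hdist_eq_0_iff[of c d] * len by (auto simp: hdist_def)
      have "{j. j < length (flip c i) \<and> flip c i ! j \<noteq> d ! j} \<subseteq> ?D - {i}"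
        using i by (auto simp: flip_nth split: if_splits)
      from card_mono[OF _ this] have "hdist (flip c i) d \<le> 1"
        using \<open>card ?D \<le> 2\<close> i by (simp add: hdist_def)
      moreover have "hdist (flip c i) c \<le> 1"
        using i by (subst hdist_le_1_iff) (auto intro!: exI[of _ i])
      ultimately show False
        using disj[rule_format, of "flip c i" c d] * len by auto
    qed
  qed
  also have "\<dots> \<longleftrightarrow> (\<forall>x\<in>words n. card {c \<in> C. hdist x c \<le> 1} \<le> 1)"
    using fin by (auto simp: card_le_Suc0_iff_eq)
  also have "\<dots> \<longleftrightarrow> (\<forall>x\<in>words n. ball_sum n (ind C) x \<le> 1)"
    using True by (auto simp: ball_sum_ind)
  finally show ?thesis
    using True by (simp add: distance_code_def)
qed (simp add: distance_code_def)

lemma twofold_one_perfect_iff_ball_sum: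
  "twofold_one_perfect n M \<longleftrightarrow>
    set_mset M \<subseteq> words n \<and> (\<forall>x\<in>words n. ball_sum n (\<lambda>y. int (count M y)) x = 2)"
proof (cases "set_mset M \<subseteq> words n")
  case True
  have "ball_sum n (\<lambda>y. int (count M y)) x = int (size {#c \<in># M. hdist x c \<le> 1#})"
    if "length x = n" for x
  proof -
    have "size {#c \<in># M. hdist x c \<le> 1#}
        = (\<Sum>c\<in>set_mset M \<inter> {c. hdist x c \<le> 1}. count M c)"
      by (auto simp: size_multiset_overloaded_eq intro!: sum.cong)
    also have "\<dots> = (\<Sum>c\<in>{y \<in> words n. hdist x y \<le> 1}. count M c)"
      using True by (intro sum.mono_neutral_left finite_subset[OF _ finite_words[of n]]) (auto simp: not_in_iff)
    finally show ?thesis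
      using that by (simp add: ball_sum_eq_sum_ball)
  qed
  then show ?thesis
    using True unfolding twofold_one_perfect_def by fastforce
qed (simp add: twofold_one_perfect_def)

section \<open>Characters of the hypercube\<close>

definition chi :: "nat set \<Rightarrow> word \<Rightarrow> int" where
  "chi S x = (\<Prod>i\<in>S. if x ! i then - 1 else 1)"

definition fourier :: "nat \<Rightarrow> (word \<Rightarrow> int) \<Rightarrow> nat set \<Rightarrow> int" where
  "fourier n h S = (\<Sum>x\<in>words n. h x * chi S x)"

lemma chi_flip:
  assumes "S \<subseteq> {..<length x}" "i < length x"
  shows "chi S (flip x i) = (if i \<in> S then - chi S x else chi S x)"
proof -
  have "finite S" using assms(1) finite_subset by blast
  show ?thesis
  proof (cases "i \<in> S")
    case True
    have "(\<Prod>j\<in>S - {i}. if flip x i ! j then - 1 else 1 :: int)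
        = (\<Prod>j\<in>S - {i}. if x ! j then - 1 else 1)"
      by (rule prod.cong) (use assms in \<open>auto simp: flip_nth\<close>)
    then show ?thesis
      using True assms(2) \<open>finite S\<close>
      by (simp add: chi_def prod.remove[of S i] flip_nth)
  next
    case False
    then show ?thesis
      unfolding chi_def using assms by (auto intro!: prod.cong simp: flip_nth)
  qed
qed

lemma chi_complement:
  assumes "S \<subseteq> {..<length x}"
  shows "chi S (map Not x) = (- 1) ^ card S * chi S x"
proof -
  have "chi S (map Not x) = (\<Prod>i\<in>S. - 1 * (if x ! i then - 1 else 1))"
    unfolding chi_def by (rule prod.cong) (use assms in auto)
  then show ?thesis
    unfolding prod.distrib by (simp add: chi_def)
qed

lemma sum_chi_mult:
  assumes "length x = n" "length y = n"
  shows "(\<Sum>S\<in>Pow {..<n}. chi S x * chi S y) = (if x = y then 2 ^ n else 0)"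
proof -
  let ?e = "\<lambda>i. (if x ! i then - 1 else 1) * (if y ! i then - 1 else 1 :: int)"
  have A: "(\<Prod>i<n. ?e i + 1) = (\<Sum>S\<in>Pow {..<n}. (\<Prod>i\<in>S. ?e i) * (\<Prod>i\<in>{..<n} - S. 1))"
    by (rule prod_add) simp
  have B: "(\<Prod>i\<in>S. ?e i) * (\<Prod>i\<in>{..<n} - S. 1) = chi S x * chi S y" for S
    unfolding chi_def prod.distrib by simp
  have C: "(\<Prod>i<n. ?e i + 1) = (\<Sum>S\<in>Pow {..<n}. chi S x * chi S y)"
    unfolding A B ..
  have "(\<Prod>i<n. ?e i + 1) = (if x = y then 2 ^ n else 0)"
  proof (cases "x = y")
    case False
    then obtain i where "i < n" "x ! i \<noteq> y ! i"
      using assms by (auto simp: list_eq_iff_nth_eq)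
    then have "?e i + 1 = 0" by simp
    then have "(\<Prod>i<n. ?e i + 1) = 0"
      using \<open>i < n\<close> prod_zero[of "{..<n}" "\<lambda>i. ?e i + 1"] by blast
    then show ?thesis using False by simp
  next
    case True
    then have "(\<Prod>i<n. ?e i + 1) = (\<Prod>i<n. 2)"
      by (intro prod.cong) auto
    then show ?thesis using True by simp
  qed
  then show ?thesis unfolding C .
qed

lemma parseval:
  "(\<Sum>S\<in>Pow {..<n}. fourier n g S * fourier n h S) = 2 ^ n * (\<Sum>x\<in>words n. g x * h x)"
proof -
  have "(\<Sum>S\<in>Pow {..<n}. fourier n g S * fourier n h S)
      = (\<Sum>S\<in>Pow {..<n}. \<Sum>x\<in>words n. \<Sum>y\<in>words n. g x * h y * (chi S x * chi S y))"
    by (simp add: fourier_def sum_product algebra_simps)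
  also have "\<dots> = (\<Sum>x\<in>words n. \<Sum>S\<in>Pow {..<n}. \<Sum>y\<in>words n. g x * h y * (chi S x * chi S y))"
    by (rule sum.swap)
  also have "\<dots> = (\<Sum>x\<in>words n. \<Sum>y\<in>words n. \<Sum>S\<in>Pow {..<n}. g x * h y * (chi S x * chi S y))"
    by (intro sum.cong refl sum.swap)
  also have "\<dots> = (\<Sum>x\<in>words n. \<Sum>y\<in>words n. g x * h y * (if x = y then 2 ^ n else 0))"
    unfolding sum_distrib_left[symmetric] by (intro sum.cong refl) (simp add: sum_chi_mult)
  also have "\<dots> = (\<Sum>x\<in>words n. g x * h x * 2 ^ n)"
    by (intro sum.cong refl) (simp add: if_distrib[of "\<lambda>t. _ * t"] del: mem_words cong: if_cong)
  finally show ?thesis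
    by (simp add: sum_distrib_left mult.commute)
qed

lemma fourier_eq_0_imp_eq_0:
  assumes "\<And>S. S \<subseteq> {..<n} \<Longrightarrow> fourier n h S = 0" "length x = n"
  shows "h x = 0"
proof -
  have "(\<Sum>x\<in>words n. h x * h x) = 0"
    using parseval[of n h h] assms(1) by simp
  then show ?thesis
    using assms(2) by (simp add: sum_nonneg_eq_0_iff)
qed

lemma fourier_add: "fourier n (\<lambda>x. g x + h x) S = fourier n g S + fourier n h S"
  and fourier_diff: "fourier n (\<lambda>x. g x - h x) S = fourier n g S - fourier n h S"
  and fourier_cmult: "fourier n (\<lambda>x. c * h x) S = c * fourier n h S"
  by (simp_all add: fourier_def sum.distrib sum_subtractf sum_distrib_left algebra_simps)

text \<open>The characters are eigenfunctions of the ball-sum operator, with an eigenvalue that depends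
  on the cardinality of \<^term>\<open>S\<close> only.\<close>

lemma fourier_ball_sum:
  assumes "S \<subseteq> {..<n}"
  shows "fourier n (ball_sum n h) S = (int n + 1 - 2 * int (card S)) * fourier n h S"
proof -
  have "(\<Sum>x\<in>words n. h (flip x i) * chi S x) = (if i \<in> S then - 1 else 1) * fourier n h S"
    if "i < n" for i
  proof -
    have "(\<Sum>x\<in>words n. h (flip x i) * chi S x) = (\<Sum>x\<in>words n. h x * chi S (flip x i))"
      by (rule sum.reindex_bij_witness[of _ "\<lambda>x. flip x i" "\<lambda>x. flip x i"]) auto
    also have "\<dots> = (\<Sum>x\<in>words n. (if i \<in> S then - 1 else 1) * (h x * chi S x))"
      by (rule sum.cong) (use assms that in \<open>auto simp: chi_flip\<close>)
    finally show ?thesis by (simp add: fourier_def sum_distrib_left)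
  qed
  then have "(\<Sum>i<n. \<Sum>x\<in>words n. h (flip x i) * chi S x)
      = (\<Sum>i<n. (if i \<in> S then - 1 else 1)) * fourier n h S"
    by (simp add: sum_distrib_right)
  moreover have "(\<Sum>i<n. if i \<in> S then - 1 else 1 :: int) = int n - 2 * int (card S)"
  proof -
    have "{..<n} \<inter> S = S" "{..<n} \<inter> - S = {..<n} - S" using assms by auto
    moreover have "card ({..<n} - S) = n - card S" "card S \<le> n"
      using assms card_mono[OF _ assms] by (auto simp: card_Diff_subset finite_subset)
    ultimately show ?thesis by (simp add: sum.If_cases)
  qed
  moreover have "fourier n (ball_sum n h) S
      = fourier n h S + (\<Sum>i<n. \<Sum>x\<in>words n. h (flip x i) * chi S x)"
    unfolding fourier_def ball_sum_def
    by (subst sum.swap) (simp add: distrib_right sum.distrib sum_distrib_right)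
  ultimately show ?thesis by (simp add: algebra_simps)
qed

lemma fourier_complement:
  assumes "S \<subseteq> {..<n}"
  shows "fourier n (\<lambda>x. h (map Not x)) S = (- 1) ^ card S * fourier n h S"
proof -
  have "map (Not \<circ> Not) x = x" for x by (simp add: comp_def)
  then have "fourier n (\<lambda>x. h (map Not x)) S = (\<Sum>x\<in>words n. h x * chi S (map Not x))"
    unfolding fourier_def
    by (intro sum.reindex_bij_witness[of _ "map Not" "map Not"]) auto
  also have "\<dots> = (\<Sum>x\<in>words n. (- 1) ^ card S * (h x * chi S x))"
    by (rule sum.cong) (use assms in \<open>auto simp: chi_complement\<close>)
  finally show ?thesis by (simp add: fourier_def sum_distrib_left)
qed

text \<open>The constant function is an eigenfunction of the ball-sum operator for the eigenvalue
  belonging to the empty set, and no nonempty set shares that eigenvalue.\<close>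

lemma fourier_const:
  assumes "S \<subseteq> {..<n}" "S \<noteq> {}"
  shows "fourier n (\<lambda>x. c) S = 0"
proof -
  have "fourier n (ball_sum n (\<lambda>x. c)) S = (int n + 1) * fourier n (\<lambda>x. c) S"
    unfolding ball_sum_const by (rule fourier_cmult)
  moreover have "card S \<noteq> 0" using assms by (simp add: finite_subset)
  ultimately show ?thesis
    using fourier_ball_sum[OF assms(1), of "\<lambda>x. c"] by simp
qed

lemma fourier_empty: "fourier n h {} = (\<Sum>x\<in>words n. h x)"
  by (simp add: fourier_def chi_def)

section \<open>The code and its complement\<close>

text \<open>Shortening a 1-perfect code of length \<open>n + 2\<close> twice gives a code with this cardinality; the
  sphere-packing bound has \<^term>\<open>n + 1\<close> in place of \<^term>\<open>n + 3\<close>.\<close>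

locale doubly_shortened =
  fixes n :: nat and C :: "word set"
  assumes code: "distance_code n 3 C"
    and card_eq: "card C * (n + 3) = 2 ^ n"
    and mod_4: "n mod 4 = 1"
begin

lemma n_gt_1: "n > 1"
proof -
  have "n \<noteq> 0" using mod_4 by auto
  moreover have "n \<noteq> 1"
  proof
    assume "n = 1"
    with card_eq have "card C * 4 = 2" by simp
    then show False by presburger
  qed
  ultimately show ?thesis by simp
qed

text \<open>These sets are the parts \<open>C\<^sub>2\<close> and \<open>C\<^sub>4\<close> of the partition.\<close>

definition antipodal :: "word set" where
  "antipodal = {x \<in> words n. map Not x \<in> C}"

definition uncovered :: "word set" where
  "uncovered = {x \<in> words n. ball_sum n (ind C) x = 0}"

lemma subset_words: "C \<subseteq> words n" "antipodal \<subseteq> words n" "uncovered \<subseteq> words n"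
  using code by (auto simp: distance_code_def antipodal_def uncovered_def)

lemma ind_antipodal: "length x = n \<Longrightarrow> ind antipodal x = ind C (map Not x)"
  by (simp add: antipodal_def)

lemma fourier_antipodal:
  "S \<subseteq> {..<n} \<Longrightarrow> fourier n (ind antipodal) S = (- 1) ^ card S * fourier n (ind C) S"
  using fourier_complement[of S n "ind C"]
  by (simp add: fourier_def ind_antipodal cong: sum.cong_simp)

lemma ball_sum_code: "length x = n \<Longrightarrow> ball_sum n (ind C) x = 1 - ind uncovered x"
proof -
  assume x: "length x = n"
  then have "ball_sum n (ind C) x \<le> 1"
    using code by (simp add: distance_code_3_iff_ball_sum)
  moreover have "ball_sum n (ind C) x \<ge> 0"
    by (simp add: ball_sum_def sum_nonneg)
  ultimately show ?thesis
    using x by (auto simp: uncovered_def)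
qed

text \<open>The weights in the following sum are nonnegative because \<^term>\<open>n mod 4 = 1\<close> makes the
  eigenvalue of the ball-sum operator congruent to 2 modulo 4 whenever \<^term>\<open>card S\<close> is even, so
  that its square is at least 4.\<close>

lemma weight_nonneg:
  "(int n + 1 - 2 * int k)\<^sup>2 - 2 - 2 * (- 1) ^ k \<ge> 0"
proof (cases "even k")
  case True
  obtain q where "n = 4 * q + 1"
    using mod_4 by (metis mult_div_mod_eq)
  moreover obtain j where "k = 2 * j" using True by (rule evenE)
  ultimately have "(int n + 1 - 2 * int k)\<^sup>2 = 4 * (2 * (int q - int j) + 1)\<^sup>2"
    by (simp add: power2_eq_square algebra_simps)
  moreover have "2 * (int q - int j) + 1 \<noteq> 0" by presburger
  then have "(2 * (int q - int j) + 1)\<^sup>2 \<ge> 1"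
    by (metis int_one_le_iff_zero_less zero_less_power2)
  ultimately show ?thesis using True by simp
qed simp

text \<open>A linear programming bound that the cardinality attains with equality. By Parseval's identity
  the weighted sum of the squared Fourier coefficients is a count of pairs of codewords, namely
  \<open>2 ^ n * ((n - 1) * card C - 2 * J)\<close>, where \<open>J\<close> counts antipodal pairs. The empty set alone
  contributes \<open>2 ^ n * (n - 1) * card C\<close>. As no weight is negative, \<open>J\<close> and all other terms
  are 0.\<close>

lemma spectrum:
  shows fourier_support: "S \<subseteq> {..<n} \<Longrightarrow> S \<noteq> {} \<Longrightarrow> fourier n (ind C) S \<noteq> 0 \<Longrightarrow>
      (int n + 1 - 2 * int (card S))\<^sup>2 = 2 + 2 * (- 1) ^ card S"
    and disjoint_antipodal: "C \<inter> antipodal = {}"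
proof -
  let ?f = "fourier n (ind C)"
  define w where
    "w S = (?f S)\<^sup>2 * ((int n + 1 - 2 * int (card S))\<^sup>2 - 2 - 2 * (- 1) ^ card S)" for S
  define J where "J = (\<Sum>x\<in>words n. ind C x * ind antipodal x)"
  have sum_ind: "(\<Sum>x\<in>words n. ind C x) = int (card C)"
    using subset_words(1) by (simp add: Int_absorb1 del: mem_words)
  have "J \<ge> 0" unfolding J_def by (simp add: sum_nonneg)
  have w_nonneg: "w S \<ge> 0" for S
    unfolding w_def using weight_nonneg by simp
  have "(\<Sum>S\<in>Pow {..<n}. w S)
      = (\<Sum>S\<in>Pow {..<n}. fourier n (ball_sum n (ind C)) S * fourier n (ball_sum n (ind C)) S
          - 2 * (?f S * ?f S) - 2 * (?f S * fourier n (ind antipodal) S))"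
    by (intro sum.cong refl)
      (auto simp: w_def fourier_ball_sum fourier_antipodal power2_eq_square algebra_simps)
  also have "\<dots> = 2 ^ n * ((\<Sum>x\<in>words n. ball_sum n (ind C) x * ball_sum n (ind C) x)
      - 2 * (\<Sum>x\<in>words n. ind C x * ind C x) - 2 * J)"
    unfolding sum_subtractf sum_distrib_left[symmetric] parseval J_def by (simp add: algebra_simps)
  also have "(\<Sum>x\<in>words n. ball_sum n (ind C) x * ball_sum n (ind C) x)
      = (\<Sum>x\<in>words n. ball_sum n (ind C) x)"
    by (intro sum.cong refl) (auto simp: ball_sum_code)
  also have "\<dots> = (int n + 1) * int (card C)"
    using fourier_ball_sum[of "{}" n "ind C"] sum_ind by (simp add: fourier_empty)
  also have "(\<Sum>x\<in>words n. ind C x * ind C x) = int (card C)"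
    using sum_ind by (simp add: of_bool_conj[symmetric] del: sum_of_bool_eq)
  finally have total: "(\<Sum>S\<in>Pow {..<n}. w S) = 2 ^ n * ((int n - 1) * int (card C) - 2 * J)"
    by (simp add: algebra_simps)
  have "w {} = int (card C) * (int (card C) * (int n + 3)) * (int n - 1)"
    by (simp add: w_def fourier_empty sum_ind power2_eq_square algebra_simps del: sum_of_bool_eq)
  also have "int (card C) * (int n + 3) = 2 ^ n"
    using arg_cong[OF card_eq, of int] by simp
  finally have "(\<Sum>S\<in>Pow {..<n} - {{}}. w S) = - 2 * 2 ^ n * J"
    using total by (simp add: sum_diff1 algebra_simps)
  moreover have "(\<Sum>S\<in>Pow {..<n} - {{}}. w S) \<ge> 0"
    by (simp add: sum_nonneg w_nonneg)
  ultimately have "2 ^ n * J \<le> 0" "(\<Sum>S\<in>Pow {..<n} - {{}}. w S) = - 2 * (2 ^ n * J)"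
    by linarith+
  then have "J = 0" and w_sum: "(\<Sum>S\<in>Pow {..<n} - {{}}. w S) = 0"
    using \<open>J \<ge> 0\<close> by (auto simp: mult_le_0_iff)
  from w_sum have w_0: "w S = 0" if "S \<subseteq> {..<n}" "S \<noteq> {}" for S
    using that w_nonneg by (subst (asm) sum_nonneg_eq_0_iff) auto
  show "(int n + 1 - 2 * int (card S))\<^sup>2 = 2 + 2 * (- 1) ^ card S"
    if "S \<subseteq> {..<n}" "S \<noteq> {}" "?f S \<noteq> 0" for S
  proof -
    have "(int n + 1 - 2 * int (card S))\<^sup>2 - 2 - 2 * (- 1) ^ card S = 0"
      using w_0[OF that(1,2)] that(3) unfolding w_def mult_eq_0_iff power_eq_0_iff by blast
    then show ?thesis by linarith
  qed
  have "ind C x * ind antipodal x = 0" if "x \<in> words n" for x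
    using \<open>J = 0\<close> that unfolding J_def by (subst (asm) sum_nonneg_eq_0_iff) auto
  then show "C \<inter> antipodal = {}"
    using subset_words by (fastforce simp: of_bool_def split: if_splits)
qed

text \<open>The difference of the indicator functions of the code and of its antipode has Fourier
  coefficients only at sets of odd cardinality. There the support condition says that the eigenvalue
  of the ball-sum operator is 0, so both functions have the same ball sums.\<close>

lemma ball_sum_antipodal:
  assumes "length x = n"
  shows "ball_sum n (ind antipodal) x = 1 - ind uncovered x"
proof -
  have "fourier n (\<lambda>y. ball_sum n (ind C) y - ball_sum n (ind antipodal) y) S = 0"
    if "S \<subseteq> {..<n}" for S
    using fourier_support[of S] that
    by (cases "S = {}"; cases "even (card S)")
      (auto simp: fourier_diff fourier_ball_sum fourier_antipodal)
  from fourier_eq_0_imp_eq_0[OF this assms] show ?thesis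
    using ball_sum_code[OF assms] by simp
qed

text \<open>The sum \<open>F\<close> of the two indicator functions has Fourier coefficients only at sets of even
  cardinality. There, except at the empty set, the square of the ball-sum operator acts as
  multiplication by 4; the empty set accounts for the constant. One application of the operator turns
  \<open>F\<close> into twice the indicator function of the covered words, so the second one yields the ball
  sums of the uncovered words.\<close>

lemma ball_sum_uncovered:
  assumes "length x = n"
  shows "ball_sum n (ind uncovered) x = 2 - 2 * ind C x - 2 * ind antipodal x"
proof -
  define F where "F y = ind C y + ind antipodal y" for y
  have fourier_F: "fourier n F S = (1 + (- 1) ^ card S) * fourier n (ind C) S"
    if "S \<subseteq> {..<n}" for S
    unfolding F_def fourier_add using that by (simp add: fourier_antipodal algebra_simps)
  define c where "c = 2 * (int n - 1)"
  have "fourier n (\<lambda>y. ball_sum n (ball_sum n F) y - 4 * F y - c) S = 0"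
    if S: "S \<subseteq> {..<n}" for S
  proof (cases "S = {}")
    case True
    have "fourier n (ind C) {} = int (card C)"
      using subset_words(1) by (simp add: fourier_empty Int_absorb1 del: mem_words)
    moreover have "fourier n (\<lambda>y. c) {} = c * 2 ^ n"
      by (simp add: fourier_empty card_words del: mem_words)
    moreover have "(2 :: int) ^ n = int (card C) * (int n + 3)"
      using arg_cong[OF card_eq, of int] by simp
    ultimately show ?thesis
      using True
      by (simp add: fourier_diff fourier_cmult fourier_ball_sum fourier_F)
        (simp add: c_def algebra_simps)
  next
    case False
    define mu where "mu = int n + 1 - 2 * int (card S)"
    have "mu\<^sup>2 * fourier n F S = 4 * fourier n F S"
      using fourier_support[OF S False]
      by (cases "even (card S)"; cases "fourier n (ind C) S = 0")
        (simp_all add: fourier_F[OF S] mu_def)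
    then have "mu * (mu * fourier n F S) = 4 * fourier n F S"
      by (simp add: power2_eq_square)
    then show ?thesis
      using S False
      by (simp add: fourier_diff fourier_cmult fourier_ball_sum fourier_const mu_def)
  qed
  from fourier_eq_0_imp_eq_0[OF this assms]
  have "ball_sum n (ball_sum n F) x = 4 * F x + 2 * (int n - 1)"
    by (simp add: c_def)
  moreover have "ball_sum n (ball_sum n F) x = ball_sum n (\<lambda>y. 2 - 2 * ind uncovered y) x"
    by (rule ball_sum_cong[OF assms])
      (simp add: F_def[abs_def] ball_sum_add ball_sum_code ball_sum_antipodal)
  ultimately show ?thesis
    by (simp add: F_def ball_sum_diff ball_sum_const ball_sum_cmult)
qed

text \<open>An uncovered word has only one uncovered neighbour, so some other neighbour serves as
  \<open>x\<close>.\<close>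

lemma in_ball_of_covered:
  assumes "length y = n"
  obtains x where "length x = n" "x \<notin> uncovered"
    and "\<And>d. (\<And>z. length z = n \<Longrightarrow> d z \<ge> 0) \<Longrightarrow> d y \<le> ball_sum n d x"
proof (cases "y \<in> uncovered")
  case True
  have "\<exists>i<n. flip y i \<notin> uncovered"
  proof (rule ccontr)
    assume "\<not> (\<exists>i<n. flip y i \<notin> uncovered)"
    then have "ball_sum n (ind uncovered) y = 1 + int n"
      using True by (simp add: ball_sum_def Int_absorb2 subset_iff)
    moreover have "ball_sum n (ind uncovered) y \<le> 2"
      using ball_sum_uncovered[OF assms] by simp
    ultimately show False using n_gt_1 by simp
  qed
  then obtain i where "i < n" "flip y i \<notin> uncovered" by blast
  then show ?thesis
    using assms that[of "flip y i"] ball_sum_ge_neighbour[of y n] by auto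
next
  case False
  then show ?thesis using assms that[of y] ball_sum_ge[of y n] by blast
qed

text \<open>The tool for uniqueness: \<open>d\<close> will be the excess of a layer over its forced minimum. It vanishes
  on the balls around covered words, and these balls contain every word.\<close>

lemma eq_0_if_ball_sum_le_uncovered:
  assumes "\<And>x. length x = n \<Longrightarrow> d x \<ge> 0"
    and "\<And>x. length x = n \<Longrightarrow> ball_sum n d x \<le> 2 * ind uncovered x"
    and "length y = n"
  shows "d y = 0"
proof -
  obtain x where "length x = n" "x \<notin> uncovered" "d y \<le> ball_sum n d x"
    using in_ball_of_covered[OF assms(3)] assms(1) by metis
  then show ?thesis using assms(1)[OF assms(3)] assms(2)[of x] by simp
qed

end

section \<open>Two more coordinates\<close>

text \<open>Keep the length \<^term>\<open>n + 2\<close> in the form in which the lemmas below mention it.\<close>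

declare add_2_eq_Suc' [simp del]

lemma words_add_2E:
  assumes "length w = n + 2"
  obtains x a b where "length x = n" "w = x @ [a, b]"
proof
  show "length (take n w) = n" using assms by simp
  have "length (drop n w) = 2" using assms by simp
  then have "drop n w = [w ! n, w ! (n + 1)]"
    using assms by (auto simp: list_eq_iff_nth_eq less_Suc_eq numeral_2_eq_2)
  then show "w = take n w @ [w ! n, w ! (n + 1)]"
    by (metis append_take_drop_id)
qed

lemma words_add_2_ball: "(\<forall>w\<in>words (n + 2). P w) \<longleftrightarrow> (\<forall>x\<in>words n. \<forall>a b. P (x @ [a, b]))"
proof (intro iffI ballI)
  fix w assume "\<forall>x\<in>words n. \<forall>a b. P (x @ [a, b])" "w \<in> words (n + 2)"
  then show "P w"
    using words_add_2E[of w n] by (metis mem_words)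
qed auto

lemma ball_sum_add_2:
  assumes "length x = n"
  shows "ball_sum (n + 2) h (x @ [a, b])
    = ball_sum n (\<lambda>y. h (y @ [a, b])) x + h (x @ [\<not> a, b]) + h (x @ [a, \<not> b])"
proof -
  have "flip (x @ [a, b]) i = flip x i @ [a, b]" if "i < n" for i
    using that assms by (simp add: flip_def list_update_append nth_append)
  moreover have "flip (x @ [a, b]) n = x @ [\<not> a, b]" "flip (x @ [a, b]) (Suc n) = x @ [a, \<not> b]"
    using assms by (simp_all add: flip_def list_update_append nth_append)
  ultimately show ?thesis
    by (simp add: ball_sum_def add_2_eq_Suc')
qed

lemma wadd_zeros_11:
  assumes "length x = n"
  shows "wadd (x @ [a, b]) (zeros_11 n) = x @ [\<not> a, \<not> b]"
proof -
  have "map2 (\<noteq>) x (replicate n False) = x"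
    using assms by (simp add: list_eq_iff_nth_eq)
  then show ?thesis
    using assms by (simp add: wadd_def zeros_11_def)
qed

lemma append_00_iff: "w \<in> append_00 C \<longleftrightarrow> (\<exists>x\<in>C. w = x @ [False, False])"
  by (auto simp: append_00_def)

definition four_layers :: "word set \<Rightarrow> word set \<Rightarrow> word set \<Rightarrow> word set \<Rightarrow> word set" where
  "four_layers U X Y V =
    {x @ [a, b] | x a b. x \<in> (if a then if b then V else Y else if b then X else U)}"

lemma mem_four_layers:
  "x @ [a, b] \<in> four_layers U X Y V \<longleftrightarrow> x \<in> (if a then if b then V else Y else if b then X else U)"
  by (cases a; cases b) (auto simp: four_layers_def)

lemma four_layers_subset:
  assumes "U \<subseteq> words n" "X \<subseteq> words n" "Y \<subseteq> words n" "V \<subseteq> words n"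
  shows "four_layers U X Y V \<subseteq> words (n + 2)"
  using assms unfolding four_layers_def by (auto split: if_splits)

lemma int_count_mset_set: "finite A \<Longrightarrow> int (count (mset_set A) x) = ind A x"
  by (simp add: count_mset_set')

lemma multiset_eqI_words_add_2:
  assumes "set_mset M \<subseteq> words (n + 2)" "set_mset N \<subseteq> words (n + 2)"
    and "\<And>x a b. length x = n \<Longrightarrow> int (count M (x @ [a, b])) = int (count N (x @ [a, b]))"
  shows "M = N"
proof (rule multiset_eqI)
  fix w
  show "count M w = count N w"
  proof (cases "w \<in> words (n + 2)")
    case True
    then obtain x a b where "length x = n" "w = x @ [a, b]"
      using words_add_2E[of w n] mem_words by metis
    then show ?thesis using assms(3)[of x a b] by simp
  next
    case False
    then have "w \<notin># M" "w \<notin># N" using assms(1,2) by blast+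
    then show ?thesis by (simp add: not_in_iff)
  qed
qed

lemma twofold_one_perfect_add_2_iff:
  "twofold_one_perfect (n + 2) M \<longleftrightarrow> set_mset M \<subseteq> words (n + 2) \<and>
    (\<forall>x\<in>words n. \<forall>a b. ball_sum n (\<lambda>y. int (count M (y @ [a, b]))) x
      + int (count M (x @ [\<not> a, b])) + int (count M (x @ [a, \<not> b])) = 2)"
  unfolding twofold_one_perfect_iff_ball_sum words_add_2_ball
  by (simp add: ball_sum_add_2)

text \<open>The ball around a word within a layer is part of the ball in the longer words.\<close>

lemma distance_code_layer:
  assumes "distance_code (n + 2) 3 P"
  shows "distance_code n 3 {x \<in> words n. x @ [a, b] \<in> P}"
  unfolding distance_code_3_iff_ball_sum
proof (intro conjI ballI)
  fix x assume x: "x \<in> words n"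
  have "ball_sum n (ind {x \<in> words n. x @ [a, b] \<in> P}) x
      = ball_sum n (\<lambda>y. ind P (y @ [a, b])) x"
    by (rule ball_sum_cong) (use x in auto)
  also have "\<dots> \<le> ball_sum (n + 2) (ind P) (x @ [a, b])"
    using x by (simp only: ball_sum_add_2 mem_words) simp
  also have "\<dots> \<le> 1"
    using assms x by (simp add: distance_code_3_iff_ball_sum)
  finally show "ball_sum n (ind {x \<in> words n. x @ [a, b] \<in> P}) x \<le> 1" .
qed auto

lemma splittable_layer:
  assumes "splittable (n + 2) M"
  obtains X Y where "distance_code n 3 X" "distance_code n 3 Y"
    and "\<And>x. x \<in> words n \<Longrightarrow>
      count M (x @ [a, b]) = count (mset_set X) x + count (mset_set Y) x"
proof -
  obtain P Q where PQ: "distance_code (n + 2) 3 P" "distance_code (n + 2) 3 Q"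
    "M = mset_set P + mset_set Q"
    using assms unfolding splittable_def by blast
  then have "finite P" "finite Q"
    by (auto simp: distance_code_def intro: finite_subset[OF _ finite_words])
  moreover have "finite {x. length x = n \<and> x @ [a, b] \<in> R}" for R
    by (rule finite_subset[OF _ finite_words[of n]]) auto
  ultimately show ?thesis
    using PQ that[OF distance_code_layer[OF PQ(1)] distance_code_layer[OF PQ(2)], of a b a b]
    by (simp add: count_mset_set')
qed

section \<open>The two twofold extensions\<close>

context doubly_shortened
begin

lemma finite_parts [simp]: "finite C" "finite antipodal" "finite uncovered"
  using subset_words finite_subset finite_words by blast+

text \<open>The multiplicities that the conditions on the two extensions will turn out to force.\<close>

definition doubled_profile :: "word multiset \<Rightarrow> bool" where
  "doubled_profile M \<longleftrightarrow> set_mset M \<subseteq> words (n + 2) \<and> (\<forall>x\<in>words n.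
    int (count M (x @ [False, False])) = 2 * ind C x \<and>
    int (count M (x @ [True, True])) = 2 * ind antipodal x \<and>
    int (count M (x @ [False, True])) = ind uncovered x \<and>
    int (count M (x @ [True, False])) = ind uncovered x)"

definition symmetric_profile :: "word multiset \<Rightarrow> bool" where
  "symmetric_profile M \<longleftrightarrow> set_mset M \<subseteq> words (n + 2) \<and> (\<forall>x\<in>words n.
    int (count M (x @ [False, False])) = ind C x + ind antipodal x \<and>
    int (count M (x @ [True, True])) = ind C x + ind antipodal x \<and>
    int (count M (x @ [False, True])) = ind uncovered x \<and>
    int (count M (x @ [True, False])) = ind uncovered x)"

lemma doubled_profile_unique: "doubled_profile M \<Longrightarrow> doubled_profile N \<Longrightarrow> M = N"
  unfolding doubled_profile_def
  by (rule multiset_eqI_words_add_2[of M n N], simp, simp) (case_tac a; case_tac b; simp)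

lemma symmetric_profile_unique: "symmetric_profile M \<Longrightarrow> symmetric_profile N \<Longrightarrow> M = N"
  unfolding symmetric_profile_def
  by (rule multiset_eqI_words_add_2[of M n N], simp, simp) (case_tac a; case_tac b; simp)

text \<open>A splitting of the uncovered words splits both profiles: on the layers 01 and 10 the two parts
  are used in opposite order.\<close>

lemma profile_of_splitting:
  assumes "mset_set uncovered = mset_set X + mset_set Y" "X \<subseteq> words n" "Y \<subseteq> words n"
  shows "doubled_profile
      (mset_set (four_layers C X Y antipodal) + mset_set (four_layers C Y X antipodal))"
    and "symmetric_profile
      (mset_set (four_layers C X Y antipodal) + mset_set (four_layers antipodal Y X C))"
proof -
  have fin: "finite X" "finite Y"
    using assms finite_subset finite_words by blast+
  have XY: "ind X x + ind Y x = ind uncovered x" for x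
    using arg_cong[OF assms(1), of "\<lambda>M. int (count M x)"] fin by (simp add: int_count_mset_set)
  have sub: "four_layers C X Y antipodal \<subseteq> words (n + 2)"
    "four_layers C Y X antipodal \<subseteq> words (n + 2)" "four_layers antipodal Y X C \<subseteq> words (n + 2)"
    by (intro four_layers_subset subset_words assms)+
  then have "finite (four_layers C X Y antipodal)" "finite (four_layers C Y X antipodal)"
    "finite (four_layers antipodal Y X C)"
    using finite_subset finite_words by blast+
  with sub XY show "doubled_profile
      (mset_set (four_layers C X Y antipodal) + mset_set (four_layers C Y X antipodal))"
    and "symmetric_profile
      (mset_set (four_layers C X Y antipodal) + mset_set (four_layers antipodal Y X C))"
    by (simp_all add: doubled_profile_def symmetric_profile_def int_count_mset_set mem_four_layers
        add.commute)
qed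

text \<open>The ball around a word outside \<^term>\<open>C \<union> antipodal\<close> contains two uncovered words. Each of the
  codes \<open>X\<close> and \<open>Y\<close> has at most one of them, so each has exactly one. The ball around any other
  word contains no uncovered word. These are the ball conditions on the layers 01 and 10.\<close>

lemma one_perfect_four_layers:
  assumes "mset_set uncovered = mset_set X + mset_set Y"
    and "distance_code n 3 X" "distance_code n 3 Y"
  shows "one_perfect (n + 2) (four_layers C X Y antipodal)"
    and "one_perfect (n + 2) (four_layers antipodal X Y C)"
proof -
  have sub: "X \<subseteq> words n" "Y \<subseteq> words n"
    using assms by (auto simp: distance_code_def)
  then have fin: "finite X" "finite Y"
    using finite_subset finite_words by blast+
  have XY: "ind X x + ind Y x = ind uncovered x" for x
    using arg_cong[OF assms(1), of "\<lambda>M. int (count M x)"] fin by (simp add: int_count_mset_set)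
  have XY_ball: "ball_sum n (ind X) x = 1 - ind C x - ind antipodal x
      \<and> ball_sum n (ind Y) x = 1 - ind C x - ind antipodal x"
    if x: "length x = n" for x
  proof -
    have "ball_sum n (ind X) x + ball_sum n (ind Y) x = 2 - 2 * ind C x - 2 * ind antipodal x"
      using ball_sum_uncovered[OF x] unfolding XY[symmetric] by (simp add: ball_sum_add)
    moreover have "ball_sum n (ind X) x \<le> 1" "ball_sum n (ind Y) x \<le> 1"
      using assms(2,3) x by (simp_all add: distance_code_3_iff_ball_sum)
    moreover have "ball_sum n (ind X) x \<ge> 0" "ball_sum n (ind Y) x \<ge> 0"
      by (simp_all add: ball_sum_def sum_nonneg)
    ultimately show ?thesis
      by (cases "x \<in> C"; cases "x \<in> antipodal") auto
  qed
  have "four_layers C X Y antipodal \<subseteq> words (n + 2)"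
    "four_layers antipodal X Y C \<subseteq> words (n + 2)"
    by (intro four_layers_subset subset_words sub)+
  then show "one_perfect (n + 2) (four_layers C X Y antipodal)"
    "one_perfect (n + 2) (four_layers antipodal X Y C)"
    unfolding one_perfect_iff_ball_sum words_add_2_ball using XY XY_ball
    by (simp_all add: ball_sum_add_2 mem_four_layers all_bool_eq
        ball_sum_code ball_sum_antipodal algebra_simps)
qed

text \<open>Uniqueness: on the layer 00 the ball around a covered word contains a codeword counted twice and
  no further word. So the excess of this layer over twice the code is 0 on these balls, hence 0. The ball
  conditions on the layer 00 then leave two words in total over each uncovered word on the layers 01
  and 10, which by the exchange condition are one on each, and the ball conditions on the layer 01
  determine the layer 11.\<close>

lemma doubled_extension_iff: "doubled_extension n C M \<longleftrightarrow> doubled_profile M"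
proof
  assume M: "doubled_profile M"
  have sub: "set_mset M \<subseteq> words (n + 2)" using M by (simp add: doubled_profile_def)
  have cnt: "int (count M (x @ [False, False])) = 2 * ind C x"
    "int (count M (x @ [True, True])) = 2 * ind antipodal x"
    "int (count M (x @ [False, True])) = ind uncovered x"
    "int (count M (x @ [True, False])) = ind uncovered x" if "length x = n" for x
    using M that by (simp_all add: doubled_profile_def)
  have cong: "ball_sum n (\<lambda>y. int (count M (y @ [a, b]))) x = ball_sum n
      (\<lambda>y. if a = b then 2 * ind (if a then antipodal else C) y else ind uncovered y) x"
    if "length x = n" for x a b
    by (rule ball_sum_cong[OF that]) (cases a; cases b; simp add: cnt)
  have "twofold_one_perfect (n + 2) M"
    unfolding twofold_one_perfect_add_2_iff using sub
    by (auto simp: all_bool_eq cong cnt ball_sum_cmult ball_sum_code ball_sum_antipodal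
        ball_sum_uncovered)
  moreover have count_C: "\<forall>w\<in>append_00 C. count M w = 2"
  proof
    fix w assume "w \<in> append_00 C"
    then obtain x where "x \<in> C" "w = x @ [False, False]" by (auto simp: append_00_iff)
    then show "count M w = 2" using cnt(1)[of x] subset_words by auto
  qed
  moreover from count_C have "append_00 C \<subseteq> set_mset M"
    by (metis count_eq_zero_iff subsetI zero_neq_numeral)
  moreover have "wadd w (zeros_11 n) \<in># M"
    if "w \<in># M" "drop n w \<in> {[False, True], [True, False]}" for w
  proof -
    have "length w = n + 2" using sub that(1) by auto
    then obtain x a b where w: "length x = n" "w = x @ [a, b]" by (rule words_add_2E)
    have "count M (x @ [True, False]) = count M (x @ [False, True])"
      using cnt(3,4)[OF w(1)] by simp
    then have "count M w = count M (wadd w (zeros_11 n))"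
      using that(2) w by (auto simp: wadd_zeros_11)
    then show ?thesis using that(1) by (metis count_eq_zero_iff)
  qed
  ultimately show "doubled_extension n C M"
    unfolding doubled_extension_def by blast
next
  assume M: "doubled_extension n C M"
  define H where "H a b x = int (count M (x @ [a, b]))" for a b x
  have twofold: "twofold_one_perfect (n + 2) M"
    using M by (simp add: doubled_extension_def)
  then have sub: "set_mset M \<subseteq> words (n + 2)"
    by (simp add: twofold_one_perfect_def)
  have eq: "ball_sum n (H a b) x + H (\<not> a) b x + H a (\<not> b) x = 2" if "length x = n" for a b x
    using twofold that by (simp add: twofold_one_perfect_add_2_iff H_def[abs_def])
  have nonneg: "H a b x \<ge> 0" for a b x by (simp add: H_def)
  have "H False False x = 2" if "x \<in> C" for x
    using M that by (auto simp: doubled_extension_def append_00_iff H_def)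
  then have ge: "H False False x \<ge> 2 * ind C x" for x
    using nonneg[of False False x] by (cases "x \<in> C") auto
  have "H True False x > 0 \<longleftrightarrow> H False True x > 0" if x: "length x = n" for x
  proof -
    have "wadd w (zeros_11 n) \<in># M" if "w \<in># M" "drop n w \<in> {[False, True], [True, False]}" for w
      using M that by (simp add: doubled_extension_def)
    from this[of "x @ [True, False]"] this[of "x @ [False, True]"] show ?thesis
      using x by (auto simp: H_def wadd_zeros_11)
  qed
  note supp = this
  define d where "d x = H False False x - 2 * ind C x" for x
  have "d x = 0" if "length x = n" for x
  proof (rule eq_0_if_ball_sum_le_uncovered[OF _ _ that])
    fix y :: word assume y: "length y = n"
    show "d y \<ge> 0" using ge by (simp add: d_def)
    show "ball_sum n d y \<le> 2 * ind uncovered y"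
      using eq[OF y, of False False] nonneg[of True False y] nonneg[of False True y]
      by (simp add: d_def[abs_def] ball_sum_diff ball_sum_cmult ball_sum_code[OF y])
  qed
  then have H00: "H False False x = 2 * ind C x" if "length x = n" for x
    using that by (simp add: d_def)
  have sum_H: "H True False x + H False True x = 2 * ind uncovered x" if "length x = n" for x
  proof -
    have "ball_sum n (H False False) x = ball_sum n (\<lambda>y. 2 * ind C y) x"
      by (rule ball_sum_cong[OF that]) (rule H00)
    then show ?thesis
      using eq[OF that, of False False] by (simp add: ball_sum_cmult ball_sum_code[OF that])
  qed
  have H01: "H True False x = ind uncovered x" "H False True x = ind uncovered x"
    if "length x = n" for x
    using sum_H[OF that] supp[OF that] nonneg[of True False x] nonneg[of False True x]
    by (cases "x \<in> uncovered"; force)+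
  have H11: "H True True x = 2 * ind antipodal x" if "length x = n" for x
  proof -
    have "ball_sum n (H False True) x = ball_sum n (ind uncovered) x"
      by (rule ball_sum_cong[OF that]) (rule H01)
    then show ?thesis
      using eq[OF that, of False True] H00[OF that] ball_sum_uncovered[OF that] by simp
  qed
  show "doubled_profile M"
    unfolding doubled_profile_def using sub H00 H01 H11 by (auto simp: H_def)
qed

text \<open>Here both layers 00 and 11 contain every codeword, but only once. Before the excess of these
  layers can be estimated as in the doubled case, the antipodal words must be found on them. They
  follow from the ball conditions on the layers 01 and 10: these layers have only uncovered words,
  and no such word is near an antipodal one.\<close>

lemma symmetric_extension_iff: "symmetric_extension n C M \<longleftrightarrow> symmetric_profile M"
proof
  assume M: "symmetric_profile M"
  have sub: "set_mset M \<subseteq> words (n + 2)" using M by (simp add: symmetric_profile_def)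
  have cnt: "int (count M (x @ [a, b])) =
      (if a = b then ind C x + ind antipodal x else ind uncovered x)" if "length x = n" for x a b
    using M that by (cases a; cases b) (simp_all add: symmetric_profile_def)
  have cong: "ball_sum n (\<lambda>y. int (count M (y @ [a, b]))) x = ball_sum n
      (\<lambda>y. if a = b then ind C y + ind antipodal y else ind uncovered y) x"
    if "length x = n" for x a b
    by (rule ball_sum_cong[OF that]) (rule cnt)
  have "twofold_one_perfect (n + 2) M"
    unfolding twofold_one_perfect_add_2_iff using sub
    by (auto simp: all_bool_eq cong cnt ball_sum_add ball_sum_code ball_sum_antipodal
        ball_sum_uncovered)
  moreover have "append_00 C \<subseteq> set_mset M"
  proof
    fix w assume "w \<in> append_00 C"
    then obtain x where "x \<in> C" "w = x @ [False, False]" by (auto simp: append_00_iff)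
    moreover from this have "length x = n" using subset_words(1) by auto
    ultimately have "int (count M w) > 0" using cnt[of x False False] by simp
    then show "w \<in># M" by (simp only: of_nat_0_less_iff count_greater_zero_iff)
  qed
  moreover have "wadd w (zeros_11 n) \<in># M" if "w \<in># M" for w
  proof -
    have "length w = n + 2" using sub that(1) by auto
    then obtain x a b where w: "length x = n" "w = x @ [a, b]" by (rule words_add_2E)
    have "int (count M (wadd w (zeros_11 n))) = int (count M w)"
      unfolding w(2) wadd_zeros_11[OF w(1)] cnt[OF w(1)] by simp
    then show ?thesis using that by (metis count_eq_zero_iff of_nat_eq_iff)
  qed
  ultimately show "symmetric_extension n C M"
    unfolding symmetric_extension_def by blast
next
  assume M: "symmetric_extension n C M"
  define H where "H a b x = int (count M (x @ [a, b]))" for a b x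
  have twofold: "twofold_one_perfect (n + 2) M"
    using M by (simp add: symmetric_extension_def)
  then have sub: "set_mset M \<subseteq> words (n + 2)"
    by (simp add: twofold_one_perfect_def)
  have eq: "ball_sum n (H a b) x + H (\<not> a) b x + H a (\<not> b) x = 2" if "length x = n" for a b x
    using twofold that by (simp add: twofold_one_perfect_add_2_iff H_def[abs_def])
  have nonneg: "H a b x \<ge> 0" for a b x by (simp add: H_def)
  have supp: "H (\<not> a) (\<not> b) x > 0 \<longleftrightarrow> H a b x > 0" if x: "length x = n" for a b x
  proof -
    have "wadd w (zeros_11 n) \<in># M" if "w \<in># M" for w
      using M that by (simp add: symmetric_extension_def)
    from this[of "x @ [a, b]"] this[of "x @ [\<not> a, \<not> b]"] show ?thesis
      using x by (auto simp: H_def wadd_zeros_11)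
  qed
  have on_C: "H a a x > 0" if "x \<in> C" for a x
  proof -
    have "H False False x > 0"
      using M that by (auto simp: symmetric_extension_def append_00_iff H_def)
    then show ?thesis
      using supp[of x False False] that subset_words by (cases a) auto
  qed
  \<comment> \<open>At a codeword the two words on the layers 00 and 11 exhaust the balls around its copies on
    the layers 01 and 10, which keeps these layers free of words near the code.\<close>
  have cross_le: "H a (\<not> a) x \<le> ind uncovered x" if x: "length x = n" for a x
  proof (cases "x \<in> uncovered")
    case True
    have "ball_sum n (H a a) x \<ge> 0"
      by (simp add: ball_sum_def sum_nonneg nonneg)
    then have "H (\<not> a) a x + H a (\<not> a) x \<le> 2"
      using eq[OF x, of a a] by simp
    then show ?thesis
      using True supp[OF x, of a "\<not> a"] nonneg[of a "\<not> a" x] by auto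
  next
    case False
    have "\<exists>c\<in>C. H a (\<not> a) x \<le> ball_sum n (H a (\<not> a)) c"
    proof (cases "x \<in> C")
      case True
      then show ?thesis using ball_sum_ge[OF x, of "H a (\<not> a)"] nonneg by blast
    next
      case not_C: False
      have "ball_sum n (ind C) x > 0" using False ball_sum_code[OF x] by simp
      then obtain i where "i < n" "flip x i \<in> C" using not_C by (rule ball_sum_ind_pos)
      then show ?thesis using ball_sum_ge_neighbour[OF x, of "H a (\<not> a)"] nonneg by blast
    qed
    then obtain c where c: "c \<in> C" "H a (\<not> a) x \<le> ball_sum n (H a (\<not> a)) c" ..
    moreover have "ball_sum n (H a (\<not> a)) c \<le> 0"
      using eq[of c a "\<not> a"] on_C[OF c(1), of a] on_C[OF c(1), of "\<not> a"] c(1) subset_words by auto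
    ultimately show ?thesis by simp
  qed
  have ge: "H a a x \<ge> ind C x + ind antipodal x" if x: "length x = n" for a x
  proof (cases "x \<in> C \<union> antipodal")
    case True
    have "ball_sum n (H a (\<not> a)) x \<le> ball_sum n (ind uncovered) x"
      by (rule ball_sum_mono[OF x]) (rule cross_le)
    moreover have "ball_sum n (ind uncovered) x \<le> 0"
      using ball_sum_uncovered[OF x] True by (cases "x \<in> C"; cases "x \<in> antipodal") auto
    ultimately have "H a a x + H (\<not> a) (\<not> a) x > 0"
      using eq[OF x, of a "\<not> a"] by simp
    then show ?thesis
      using supp[OF x, of a a] nonneg[of a a x] nonneg[of "\<not> a" "\<not> a" x] disjoint_antipodal True
      by auto
  qed (use nonneg in auto)
  have H00: "H a a x = ind C x + ind antipodal x" if x: "length x = n" for a x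
  proof -
    define d where "d y = H a a y - (ind C y + ind antipodal y)" for y
    have "d x = 0"
    proof (rule eq_0_if_ball_sum_le_uncovered[OF _ _ x])
      fix y :: word assume y: "length y = n"
      show "d y \<ge> 0" using ge[OF y] by (simp add: d_def)
      show "ball_sum n d y \<le> 2 * ind uncovered y"
        using eq[OF y, of a a] nonneg[of "\<not> a" a y] nonneg[of a "\<not> a" y]
        by (simp add: d_def[abs_def] ball_sum_diff ball_sum_add ball_sum_code[OF y]
            ball_sum_antipodal[OF y])
    qed
    then show ?thesis by (simp add: d_def)
  qed
  have H01: "H True False x = ind uncovered x" "H False True x = ind uncovered x"
    if x: "length x = n" for x
  proof -
    have "ball_sum n (H False False) x = ball_sum n (\<lambda>y. ind C y + ind antipodal y) x"
      by (rule ball_sum_cong[OF x]) (rule H00)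
    then have "H True False x + H False True x = 2 * ind uncovered x"
      using eq[OF x, of False False]
      by (simp add: ball_sum_add ball_sum_code[OF x] ball_sum_antipodal[OF x])
    then show "H True False x = ind uncovered x" "H False True x = ind uncovered x"
      using cross_le[OF x, of True] cross_le[OF x, of False] by auto
  qed
  show "symmetric_profile M"
    unfolding symmetric_profile_def using sub H00 H01 by (auto simp: H_def)
qed

section \<open>Lengthening and splitting\<close>

text \<open>Adding to a 1-perfect code its image under exchanging the last two symbols gives the doubled
  extension, whose layer 01 then consists of the layers 01 and 10 of the given code.\<close>

lemma doubled_profile_of_one_perfect:
  assumes P: "one_perfect (n + 2) P" "append_00 C \<subseteq> P"
  obtains Q where "distance_code (n + 2) 3 P" "distance_code (n + 2) 3 Q"
    and "doubled_profile (mset_set P + mset_set Q)"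
proof -
  define swap where "swap a b = {x \<in> words n. x @ [b, a] \<in> P}" for a b
  define Q where "Q = four_layers (swap False False) (swap False True) (swap True False) (swap True True)"
  have "swap a b \<subseteq> words n" for a b by (auto simp: swap_def)
  then have "Q \<subseteq> words (n + 2)"
    unfolding Q_def by (intro four_layers_subset)
  with P(1) have sub: "P \<subseteq> words (n + 2)" "Q \<subseteq> words (n + 2)"
    by (simp_all add: one_perfect_def)
  then have fin: "finite P" "finite Q" using finite_subset finite_words by blast+
  have Q: "x @ [a, b] \<in> Q \<longleftrightarrow> x @ [b, a] \<in> P" if "length x = n" for x a b
    using that by (cases a; cases b) (auto simp: Q_def mem_four_layers swap_def)
  have P_ball: "ball_sum n (\<lambda>y. ind P (y @ [a, b])) x + ind P (x @ [\<not> a, b]) + ind P (x @ [a, \<not> b]) = 1"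
    if "length x = n" for a b x
    using P(1) that unfolding one_perfect_iff_ball_sum words_add_2_ball
    by (simp add: ball_sum_add_2)
  have Q_ball: "ball_sum n (\<lambda>y. ind Q (y @ [a, b])) x + ind Q (x @ [\<not> a, b]) + ind Q (x @ [a, \<not> b]) = 1"
    if "length x = n" for a b x
  proof -
    have "ball_sum n (\<lambda>y. ind Q (y @ [a, b])) x = ball_sum n (\<lambda>y. ind P (y @ [b, a])) x"
      by (rule ball_sum_cong[OF that]) (simp add: Q)
    then show ?thesis using P_ball[OF that, of b a] by (simp add: Q[OF that])
  qed
  have "one_perfect (n + 2) Q"
    unfolding one_perfect_iff_ball_sum words_add_2_ball using sub(2) Q_ball
    by (simp add: ball_sum_add_2)
  then have dist: "distance_code (n + 2) 3 P" "distance_code (n + 2) 3 Q"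
    using P(1) by (simp_all add: one_perfect_iff_ball_sum distance_code_3_iff_ball_sum)
  have "doubled_extension n C (mset_set P + mset_set Q)"
    unfolding doubled_extension_def
  proof (intro conjI ballI allI impI)
    show "twofold_one_perfect (n + 2) (mset_set P + mset_set Q)"
      using \<open>one_perfect (n + 2) Q\<close> P(1) fin sub
      by (simp add: twofold_one_perfect_iff_ball_sum one_perfect_iff_ball_sum ball_sum_add
          int_count_mset_set)
  next
    fix w assume w: "w \<in> append_00 C"
    then obtain x where x: "x \<in> C" "w = x @ [False, False]" by (auto simp: append_00_iff)
    then have "length x = n" using subset_words(1) by auto
    then have "w \<in> P" "w \<in> Q" using w P(2) Q x by auto
    then show "count (mset_set P + mset_set Q) w = 2" using fin by simp
  next
    fix w assume *: "w \<in># mset_set P + mset_set Q \<and> drop n w \<in> {[False, True], [True, False]}"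
    then have "w \<in> P \<union> Q" using fin by auto
    then have "length w = n + 2" using sub by auto
    then obtain x a b where "length x = n" "w = x @ [a, b]" by (rule words_add_2E)
    then show "wadd w (zeros_11 n) \<in># mset_set P + mset_set Q"
      using * \<open>w \<in> P \<union> Q\<close> fin Q[of x] by (auto simp: wadd_zeros_11)
  qed (use P(2) fin in auto)
  then show ?thesis
    using that dist by (simp add: doubled_extension_iff)
qed

lemma splittable_uncovered_of_layer:
  assumes "splittable (n + 2) M"
    and "\<And>x. length x = n \<Longrightarrow> int (count M (x @ [False, True])) = ind uncovered x"
  shows "splittable n (mset_set uncovered)"
proof -
  obtain X Y where XY: "distance_code n 3 X" "distance_code n 3 Y"
    "\<And>x. x \<in> words n \<Longrightarrow> count M (x @ [False, True]) = count (mset_set X) x + count (mset_set Y) x"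
    using splittable_layer[OF assms(1)] by metis
  have "mset_set uncovered = mset_set X + mset_set Y"
  proof (rule multiset_eqI)
    fix x
    show "count (mset_set uncovered) x = count (mset_set X + mset_set Y) x"
    proof (cases "x \<in> words n")
      case True
      then have "int (count (mset_set uncovered) x) = int (count (mset_set X + mset_set Y) x)"
        using XY(3)[of x] assms(2)[of x] by (simp add: int_count_mset_set)
      then show ?thesis by simp
    next
      case False
      then have "x \<notin> uncovered" "x \<notin> X" "x \<notin> Y"
        using XY(1,2) subset_words by (auto simp: distance_code_def)
      then show ?thesis by simp
    qed
  qed
  then show ?thesis using XY by (auto simp: splittable_def)
qed

lemma splittable_profiles_of_splittable_uncovered:
  assumes "splittable n (mset_set uncovered)"
  obtains B D where "doubled_profile B" "splittable (n + 2) B"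
    and "symmetric_profile D" "splittable (n + 2) D"
proof -
  obtain X Y where XY: "distance_code n 3 X" "distance_code n 3 Y"
    and split: "mset_set uncovered = mset_set X + mset_set Y"
    using assms unfolding splittable_def by blast
  have split': "mset_set uncovered = mset_set Y + mset_set X" using split by simp
  have sub: "X \<subseteq> words n" "Y \<subseteq> words n" using XY by (auto simp: distance_code_def)
  have "distance_code (n + 2) 3 (four_layers C X Y antipodal)"
    "distance_code (n + 2) 3 (four_layers C Y X antipodal)"
    "distance_code (n + 2) 3 (four_layers antipodal Y X C)"
    using one_perfect_four_layers[OF split XY] one_perfect_four_layers[OF split' XY(2,1)]
    by (simp_all add: one_perfect_iff_ball_sum distance_code_3_iff_ball_sum)
  then show ?thesis
    using that[OF profile_of_splitting(1)[OF split sub] _ profile_of_splitting(2)[OF split sub]]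
    by (auto simp: splittable_def)
qed

lemma lengthening_iff_splittable_uncovered:
  "(\<exists>P. one_perfect (n + 2) P \<and> append_00 C \<subseteq> P) \<longleftrightarrow> splittable n (mset_set uncovered)"
proof
  assume "\<exists>P. one_perfect (n + 2) P \<and> append_00 C \<subseteq> P"
  then obtain P where "one_perfect (n + 2) P" "append_00 C \<subseteq> P" by blast
  then obtain Q where "distance_code (n + 2) 3 P" "distance_code (n + 2) 3 Q"
    and prof: "doubled_profile (mset_set P + mset_set Q)"
    by (rule doubled_profile_of_one_perfect)
  then have "splittable (n + 2) (mset_set P + mset_set Q)"
    by (auto simp: splittable_def)
  then show "splittable n (mset_set uncovered)"
    by (rule splittable_uncovered_of_layer) (use prof in \<open>simp add: doubled_profile_def\<close>)
next
  assume "splittable n (mset_set uncovered)"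
  then obtain X Y where XY: "distance_code n 3 X" "distance_code n 3 Y"
    "mset_set uncovered = mset_set X + mset_set Y"
    unfolding splittable_def by blast
  have "append_00 C \<subseteq> four_layers C X Y antipodal"
    by (auto simp: append_00_iff mem_four_layers)
  then show "\<exists>P. one_perfect (n + 2) P \<and> append_00 C \<subseteq> P"
    using one_perfect_four_layers(1)[OF XY(3,1,2)] by blast
qed

lemma splittable_doubled_profile_iff:
  assumes "doubled_profile B"
  shows "splittable (n + 2) B \<longleftrightarrow> splittable n (mset_set uncovered)"
proof
  assume "splittable (n + 2) B"
  then show "splittable n (mset_set uncovered)"
    by (rule splittable_uncovered_of_layer) (use assms in \<open>simp add: doubled_profile_def\<close>)
next
  assume "splittable n (mset_set uncovered)"
  then show "splittable (n + 2) B"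
    using splittable_profiles_of_splittable_uncovered doubled_profile_unique[OF assms] by metis
qed

lemma splittable_symmetric_profile_iff:
  assumes "symmetric_profile D"
  shows "splittable (n + 2) D \<longleftrightarrow> splittable n (mset_set uncovered)"
proof
  assume "splittable (n + 2) D"
  then show "splittable n (mset_set uncovered)"
    by (rule splittable_uncovered_of_layer) (use assms in \<open>simp add: symmetric_profile_def\<close>)
next
  assume "splittable n (mset_set uncovered)"
  then show "splittable (n + 2) D"
    using splittable_profiles_of_splittable_uncovered symmetric_profile_unique[OF assms] by metis
qed

text \<open>Splitting the uncovered words trivially, into all of them and none, gives multisets with the
  right counts.\<close>

lemma ex1_profiles: "\<exists>!B. doubled_profile B" "\<exists>!D. symmetric_profile D"
proof -
  have "mset_set uncovered = mset_set uncovered + mset_set {}" by simp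
  from profile_of_splitting[OF this subset_words(3)]
  show "\<exists>!B. doubled_profile B" "\<exists>!D. symmetric_profile D"
    using doubled_profile_unique symmetric_profile_unique by (metis empty_subsetI)+
qed

lemma hdist_set_eq_1_iff:
  assumes "length x = n"
  shows "hdist_set x C = 1 \<longleftrightarrow> x \<notin> C \<and> x \<notin> uncovered"
proof -
  have "C \<noteq> {}" using card_eq by auto
  then have "hdist_set x C = 1 \<longleftrightarrow> 1 \<in> hdist x ` C \<and> (\<forall>d\<in>hdist x ` C. d \<ge> 1)"
    unfolding hdist_set_def by (intro Min_eq_iff) simp_all
  also have "\<dots> \<longleftrightarrow> (\<forall>c\<in>C. hdist x c \<noteq> 0) \<and> (\<exists>c\<in>C. hdist x c \<le> 1)"
    by (force simp: le_Suc_eq)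
  also have "(\<forall>c\<in>C. hdist x c \<noteq> 0) \<longleftrightarrow> (\<forall>c\<in>C. c \<noteq> x)"
  proof (intro ball_cong refl)
    fix c assume "c \<in> C"
    then have "length c = n" using subset_words(1) by auto
    then show "hdist x c \<noteq> 0 \<longleftrightarrow> c \<noteq> x" using hdist_eq_0_iff[of x c] assms by metis
  qed
  also have "\<dots> \<longleftrightarrow> x \<notin> C"
    by blast
  also have "(\<exists>c\<in>C. hdist x c \<le> 1) \<longleftrightarrow> x \<notin> uncovered"
    using assms subset_words(1) by (auto simp: uncovered_def ball_sum_ind)
  finally show ?thesis .
qed

text \<open>The code covers exactly the words that the antipodal code covers, hence all antipodal words.
  So the complement on the right consists of the words at distance at least 2 from the code.\<close>

lemma uncovered_eq_complement:
  "uncovered = words n - (C \<union> antipodal \<union> ({x \<in> words n. hdist_set x C = 1} - antipodal))"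
proof -
  have "x \<notin> uncovered" if "x \<in> C \<union> antipodal" for x
  proof -
    have x: "length x = n" using that subset_words by auto
    have "ind C x \<le> ball_sum n (ind C) x" "ind antipodal x \<le> ball_sum n (ind antipodal) x"
      by (rule ball_sum_ge; use x in simp)+
    then show ?thesis
      using that ball_sum_code[OF x] ball_sum_antipodal[OF x] by auto
  qed
  then have "C \<inter> uncovered = {}" "antipodal \<inter> uncovered = {}" by blast+
  moreover have "{x \<in> words n. hdist_set x C = 1} = words n - C - uncovered"
    by (rule set_eqI) (simp add: hdist_set_eq_1_iff del: One_nat_def cong: conj_cong)
  ultimately show ?thesis
    using subset_words(3) by blast
qed

end

section \<open>The characterization of lengthenable codes\<close>

theorem theorem4:
  fixes m n :: nat and C1 C2 C3 C4 :: "word set"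
  assumes "m \<ge> 3"
    and "n = 2 ^ m - 3"
    and "code_params n (2 ^ (2 ^ m - m - 3)) 3 C1"
    and "C2 = {x \<in> words n. wadd x (ones n) \<in> C1}"
    and "C3 = {x \<in> words n. hdist_set x C1 = 1} - C2"
    and "C4 = words n - (C1 \<union> C2 \<union> C3)"
  shows "(\<exists>!B. doubled_extension n C1 B) \<and>
         (\<exists>!D. symmetric_extension n C1 D) \<and>
         (\<forall>B D. doubled_extension n C1 B \<and> symmetric_extension n C1 D \<longrightarrow>
            ((\<exists>C. one_perfect (n + 2) C \<and> append_00 C1 \<subseteq> C) \<longleftrightarrow> splittable n (mset_set C4)) \<and>
            (splittable n (mset_set C4) \<longleftrightarrow> splittable (n + 2) B) \<and>
            (splittable (n + 2) B \<longleftrightarrow> splittable (n + 2) D))"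
proof -
  obtain k where m: "m = k + 3" using \<open>m \<ge> 3\<close> by (metis add.commute le_Suc_ex)
  have "(2 :: nat) ^ m = 8 * 2 ^ k" by (simp add: m power_add)
  moreover have "(2 :: nat) ^ k \<ge> k + 1" by (simp add: Suc_le_eq)
  ultimately have pow: "(2 :: nat) ^ m \<ge> m + 5" and n: "n = 8 * 2 ^ k - 3" "n + 3 = 2 ^ m"
    using assms(2) m by auto
  interpret doubly_shortened n C1
  proof
    show "distance_code n 3 C1" using assms(3) by (simp add: code_params_def)
    have "card C1 * (n + 3) = 2 ^ (2 ^ m - m - 3 + m)"
      using assms(3) n(2) by (simp add: code_params_def power_add)
    also have "2 ^ m - m - 3 + m = n" using assms(2) pow by linarith
    finally show "card C1 * (n + 3) = 2 ^ n" .
    have "n = 4 * (2 * 2 ^ k - 1) + 1" using n(1) \<open>2 ^ k \<ge> k + 1\<close> by simp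
    then obtain q where "n = 4 * q + 1" by blast
    then show "n mod 4 = 1" by simp
  qed
  have "wadd x (ones n) = map Not x" if "length x = n" for x
    using that by (simp add: wadd_def ones_def list_eq_iff_nth_eq)
  then have "C2 = antipodal"
    using assms(4) by (auto simp: antipodal_def)
  then have "C4 = uncovered"
    using assms(5,6) uncovered_eq_complement by simp
  then show ?thesis
    using ex1_profiles lengthening_iff_splittable_uncovered splittable_doubled_profile_iff
      splittable_symmetric_profile_iff
    by (simp add: doubled_extension_iff symmetric_extension_iff)
qed

end
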